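(* Let $X$ be a real Banach lattice with $\dim X\ge 2$. If $X$ has the Principal Projection Property, then $$\lambda^+(X)=\inf\{\lambda^+(Y) : Y\text{ is a nonzero finite-dimensional sublattice of }X\}$$ and $$\beta(X)=\inf\{\beta(Y) : Y\text{ is a finite-dimensional sublattice of }X\text{ with }\dim Y\ge2\}.$$
   Context: For a Banach lattice $X$, $S_X^+$ denotes the set of elements $x\in X$ with $x\ge 0$ and $\|x\|=1$. The lattice Schäffer constant is $\lambda^+(X)=\inf\{\max\{\|x-y\|,\|x+y\|\} : x,y\in S_X^+\}$. For $\dim X\ge2$, $\beta(X)=\inf\{\|x\vee y\| : x,y\in S_X^+,\ x\wedge y=0\}$. $X$ has the Principal Projection Property if for every $x\in X$ the principal band generated by $x$ is a projection band. Sublattices carry the norm and order inherited from $X$. *)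

theory Defs
  imports "HOL-Analysis.Analysis" "HOL-Library.Lattice_Algebras"
begin

class banach_lattice = banach + ordered_real_vector + lattice_ab_group_add_abs +
  assumes norm_mono_abs: "\<bar>x\<bar> \<le> \<bar>y\<bar> \<Longrightarrow> norm x \<le> norm y"

instance real :: banach_lattice
  by standard simp

definition vector_sublattice :: "'a::banach_lattice set \<Rightarrow> bool" where
  "vector_sublattice Y \<longleftrightarrow>
     subspace Y \<and> (\<forall>x\<in>Y. \<forall>y\<in>Y. sup x y \<in> Y \<and> inf x y \<in> Y)"

definition finite_dimensional :: "'a::real_vector set \<Rightarrow> bool" where
  "finite_dimensional V \<longleftrightarrow> (\<exists>B. finite B \<and> span B = V)"

text \<open>The library's \<^const>\<open>dim\<close> is \<open>0\<close> on infinite-dimensional spaces, so these are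
  admitted separately.\<close>

definition dim_at_least :: "nat \<Rightarrow> 'a::real_vector set \<Rightarrow> bool" where
  "dim_at_least n V \<longleftrightarrow> (finite_dimensional V \<longrightarrow> n \<le> dim V)"

text \<open>The following notions are relative to a sublattice \<open>Y\<close> with the norm and order of the
  ambient space; \<open>Y = UNIV\<close> gives the ambient space itself. The infima are real-valued \<^const>\<open>Inf\<close>s
  of sets bounded below by \<open>0\<close>; the sets are nonempty whenever \<open>Y \<noteq> {0}\<close> for the Schaeffer
  constant, and whenever \<open>Y\<close> has dimension at least \<open>2\<close> for \<open>beta\<close>.\<close>

definition pos_sphere :: "'a::banach_lattice set \<Rightarrow> 'a set" where
  "pos_sphere Y = {x \<in> Y. 0 \<le> x \<and> norm x = 1}"

definition lattice_schaeffer :: "'a::banach_lattice set \<Rightarrow> real" where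
  "lattice_schaeffer Y =
     Inf {max (norm (x - y)) (norm (x + y)) | x y. x \<in> pos_sphere Y \<and> y \<in> pos_sphere Y}"

definition beta :: "'a::banach_lattice set \<Rightarrow> real" where
  "beta Y = Inf {norm (sup x y) | x y. x \<in> pos_sphere Y \<and> y \<in> pos_sphere Y \<and> inf x y = 0}"

definition lattice_ideal :: "'a::banach_lattice set \<Rightarrow> bool" where
  "lattice_ideal I \<longleftrightarrow> subspace I \<and> (\<forall>x y. y \<in> I \<and> \<bar>x\<bar> \<le> \<bar>y\<bar> \<longrightarrow> x \<in> I)"

definition is_supremum :: "'a::order set \<Rightarrow> 'a \<Rightarrow> bool" where
  "is_supremum D s \<longleftrightarrow> (\<forall>d\<in>D. d \<le> s) \<and> (\<forall>u. (\<forall>d\<in>D. d \<le> u) \<longrightarrow> s \<le> u)"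

definition band :: "'a::banach_lattice set \<Rightarrow> bool" where
  "band B \<longleftrightarrow> lattice_ideal B \<and> (\<forall>D s. D \<subseteq> B \<and> is_supremum D s \<longrightarrow> s \<in> B)"

definition principal_band :: "'a::banach_lattice \<Rightarrow> 'a set" where
  "principal_band x = \<Inter> {B. band B \<and> x \<in> B}"

definition disjoint_complement :: "'a::banach_lattice set \<Rightarrow> 'a set" where
  "disjoint_complement B = {v. \<forall>u\<in>B. inf \<bar>u\<bar> \<bar>v\<bar> = 0}"

text \<open>The sum \<open>B + disjoint_complement B\<close> is automatically direct, since an element disjoint from
  itself is \<open>0\<close>.\<close>

definition projection_band :: "'a::banach_lattice set \<Rightarrow> bool" where
  "projection_band B \<longleftrightarrow>
     band B \<and> (\<forall>z. \<exists>u\<in>B. \<exists>v\<in>disjoint_complement B. z = u + v)"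

text \<open>The argument only carries the type; the property concerns the whole space.\<close>

definition principal_projection_property :: "'a::banach_lattice itself \<Rightarrow> bool" where
  "principal_projection_property _ \<longleftrightarrow> (\<forall>x::'a. projection_band (principal_band x))"

end

theory Submission
  imports Defs
begin

text \<open>
  Both constants are infima of quantities attached to pairs of points of the positive sphere, so
  passing to a sublattice can only increase them. It remains to see that every admissible pair is
  almost realised in some finite-dimensional sublattice.

  For \<open>beta\<close> this holds exactly and in every Banach lattice: a disjoint pair \<open>x, y\<close> spans a
  two-dimensional sublattice. The only other point is that a sublattice that is not contained in a
  line contains a disjoint pair at all; otherwise it would be totally ordered, and a totally ordered
  Archimedean space is a line (\<open>exists_disjoint_pair\<close>).

  For the Schaeffer constant the projection property enters through a form of Freudenthal's
  spectral theorem (\<open>freudenthal_finite_dimensional\<close>): if \<open>0 \<le> x \<le> e\<close>, then \<open>x\<close> is within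
  \<open>\<delta> e\<close> of an element of a finite-dimensional sublattice that contains \<open>e\<close>. A pair
  \<open>x, y\<close> has to be approximated simultaneously, and the choice \<open>e = x + y\<close> reduces this to a
  single element: if \<open>x'\<close> approximates \<open>x\<close>, then \<open>e - x'\<close> lies in the same sublattice and
  approximates \<open>y\<close> equally well.

  The spectral theorem itself is an induction that peels off one level at a time. The band
  generated by the positive part of \<open>x - \<delta> e\<close> splits \<open>e = p + q\<close> and \<open>x = a + b\<close> with
  \<open>\<delta> p \<le> a\<close> and \<open>b \<le> \<delta> q\<close>; one replaces \<open>b\<close> by \<open>0\<close> and continues with
  \<open>a - \<delta> p\<close> inside the ideal generated by \<open>p\<close>. The vector \<open>q\<close> is disjoint
  from that ideal, so adjoining it to a sublattice of the ideal leaves the span a sublattice.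
\<close>

section \<open>Disjointness in Banach lattices\<close>

lemma norm_mono_nonneg:
  fixes x y :: "'a::banach_lattice"
  assumes "0 \<le> x" "x \<le> y"
  shows "norm x \<le> norm y"
  using assms by (intro norm_mono_abs) auto

lemma norm_le_of_abs_le:
  fixes x y :: "'a::banach_lattice"
  assumes "\<bar>x\<bar> \<le> y"
  shows "norm x \<le> norm y"
  by (metis assms abs_ge_self norm_mono_abs order_trans)

lemma abs_scaleR_le:
  fixes x :: "'a::banach_lattice"
  shows "\<bar>c *\<^sub>R x\<bar> \<le> \<bar>c\<bar> *\<^sub>R \<bar>x\<bar>"
proof (cases "0 \<le> c")
  case True
  have "c *\<^sub>R x \<le> c *\<^sub>R \<bar>x\<bar>" "c *\<^sub>R (- x) \<le> c *\<^sub>R \<bar>x\<bar>"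
    by (rule scaleR_left_mono[OF abs_ge_self True],
        rule scaleR_left_mono[OF abs_ge_minus_self True])
  then show ?thesis using True by (intro abs_leI) auto
next
  case False
  then have c: "0 \<le> - c" by simp
  have "(- c) *\<^sub>R x \<le> (- c) *\<^sub>R \<bar>x\<bar>" "(- c) *\<^sub>R (- x) \<le> (- c) *\<^sub>R \<bar>x\<bar>"
    by (rule scaleR_left_mono[OF abs_ge_self c], rule scaleR_left_mono[OF abs_ge_minus_self c])
  then show ?thesis using False by (intro abs_leI) auto
qed

text \<open>By translation invariance the right-hand side is the infimum of \<open>a + a\<close>, \<open>a + c\<close>,
  \<open>a + b\<close> and \<open>b + c\<close>, each of which dominates the left-hand side.\<close>

lemma inf_add_le:
  fixes a b c :: "'a::banach_lattice"
  assumes "0 \<le> a" "0 \<le> b" "0 \<le> c"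
  shows "inf a (b + c) \<le> inf a b + inf a c"
proof -
  let ?z = "inf a (b + c)"
  have "?z \<le> a + b" "?z \<le> a + a" "?z \<le> b + c"
    using assms by (auto intro: le_infI1 add_increasing2)
  moreover have "?z \<le> a + c" using assms by (auto intro: le_infI1 add_increasing2)
  ultimately show ?thesis
    by (simp add: add_inf_distrib_left add_inf_distrib_right add.commute)
qed

lemma inf_scaleR_eq_0:
  fixes a b :: "'a::banach_lattice"
  assumes "0 \<le> a" "0 \<le> b" "inf a b = 0" "0 \<le> c"
  shows "inf a (c *\<^sub>R b) = 0"
proof (rule antisym)
  define k where "k = max 1 c"
  have k: "1 \<le> k" "c \<le> k" by (auto simp: k_def)
  let ?z = "inf a (c *\<^sub>R b)"
  have "?z \<le> k *\<^sub>R a"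
    using scaleR_right_mono[OF k(1) assms(1)] by (auto intro: le_infI1)
  moreover have "?z \<le> k *\<^sub>R b"
    using scaleR_right_mono[OF k(2) assms(2)] by (auto intro: le_infI2)
  ultimately have "?z /\<^sub>R k \<le> inf a b"
    using k(1) by (simp add: pos_divideR_le_eq)
  then show "?z \<le> 0"
    using k(1) assms(3) by (simp add: pos_divideR_le_eq)
  show "0 \<le> ?z" using assms by (simp add: scaleR_nonneg_nonneg)
qed

lemma disjoint_complement_iff:
  "v \<in> disjoint_complement S \<longleftrightarrow> (\<forall>u\<in>S. inf \<bar>u\<bar> \<bar>v\<bar> = 0)"
  by (simp add: disjoint_complement_def)

lemma lattice_idealD:
  assumes "lattice_ideal I" "y \<in> I" "\<bar>x\<bar> \<le> \<bar>y\<bar>"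
  shows "x \<in> I"
  using assms unfolding lattice_ideal_def by blast

lemma lattice_ideal_disjoint_complement:
  "lattice_ideal (disjoint_complement S :: 'a::banach_lattice set)"
proof -
  have mono: "x \<in> disjoint_complement S"
    if "y \<in> disjoint_complement S" "\<bar>x\<bar> \<le> \<bar>y\<bar>" for x y :: 'a
  proof -
    have "inf \<bar>u\<bar> \<bar>x\<bar> \<le> 0" if "u \<in> S" for u
      using \<open>y \<in> _\<close> \<open>\<bar>x\<bar> \<le> \<bar>y\<bar>\<close> that inf_mono[of "\<bar>u\<bar>" "\<bar>u\<bar>" "\<bar>x\<bar>" "\<bar>y\<bar>"]
      by (auto simp: disjoint_complement_iff)
    then show ?thesis by (auto simp: disjoint_complement_iff intro!: antisym)
  qed
  have add: "v + w \<in> disjoint_complement S"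
    if "v \<in> disjoint_complement S" "w \<in> disjoint_complement S" for v w :: 'a
  proof -
    have "inf \<bar>u\<bar> \<bar>v + w\<bar> \<le> 0" if "u \<in> S" for u
    proof -
      have "inf \<bar>u\<bar> \<bar>v + w\<bar> \<le> inf \<bar>u\<bar> (\<bar>v\<bar> + \<bar>w\<bar>)"
        by (intro inf_mono abs_triangle_ineq) auto
      also have "\<dots> \<le> inf \<bar>u\<bar> \<bar>v\<bar> + inf \<bar>u\<bar> \<bar>w\<bar>" by (intro inf_add_le) auto
      also have "\<dots> = 0"
        using that \<open>v \<in> _\<close> \<open>w \<in> _\<close> by (simp add: disjoint_complement_iff)
      finally show ?thesis .
    qed
    then show ?thesis by (auto simp: disjoint_complement_iff intro!: antisym)
  qed
  have scale: "c *\<^sub>R v \<in> disjoint_complement S" if "v \<in> disjoint_complement S" for c and v :: 'a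
  proof -
    have "inf \<bar>u\<bar> \<bar>c *\<^sub>R v\<bar> \<le> 0" if "u \<in> S" for u
    proof -
      have "inf \<bar>u\<bar> \<bar>c *\<^sub>R v\<bar> \<le> inf \<bar>u\<bar> (\<bar>c\<bar> *\<^sub>R \<bar>v\<bar>)"
        by (intro inf_mono abs_scaleR_le) auto
      also have "\<dots> = 0"
        using that \<open>v \<in> _\<close> by (intro inf_scaleR_eq_0) (auto simp: disjoint_complement_iff)
      finally show ?thesis .
    qed
    then show ?thesis by (auto simp: disjoint_complement_iff intro!: antisym)
  qed
  have "0 \<in> (disjoint_complement S :: 'a set)"
    by (auto simp: disjoint_complement_iff inf_absorb2)
  then show ?thesis
    using mono add scale unfolding lattice_ideal_def subspace_def by blast
qed

lemma sup_eq_add_if_disjoint: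
  fixes a b :: "'a::banach_lattice"
  assumes "inf a b = 0"
  shows "sup a b = a + b"
  using add_eq_inf_sup[of a b] assms by simp

text \<open>Closure under suprema is a form of order continuity of the lattice operations. If
  \<open>s\<close> is the supremum of \<open>D\<close> and \<open>m\<close> is the part of its positive part lying below \<open>\<bar>u\<bar>\<close>,
  then \<open>m\<close> is disjoint from the positive part of each \<open>d \<in> D\<close>, so that \<open>pprt s - m\<close> is still
  an upper bound of \<open>D\<close>. Minimality of \<open>s\<close> forces \<open>m = 0\<close>.\<close>

lemma band_disjoint_complement:
  "band (disjoint_complement S :: 'a::banach_lattice set)"
  unfolding band_def
proof (intro conjI allI impI)
  show ideal: "lattice_ideal (disjoint_complement S :: 'a set)"
    by (rule lattice_ideal_disjoint_complement)
  fix D :: "'a set" and s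
  assume "D \<subseteq> disjoint_complement S \<and> is_supremum D s"
  then have D: "D \<subseteq> disjoint_complement S" and up: "\<And>d. d \<in> D \<Longrightarrow> d \<le> s"
    and least: "\<And>u. (\<And>d. d \<in> D \<Longrightarrow> d \<le> u) \<Longrightarrow> s \<le> u"
    by (auto simp: is_supremum_def)
  show "s \<in> disjoint_complement S"
  proof (cases "D = {}")
    case True
    \<comment> \<open>The supremum of the empty set is a least element, which a vector lattice has only if it is
      trivial.\<close>
    then have le: "s \<le> u" for u by (intro least) simp
    have "0 \<le> s" using le[of "s + s"] by simp
    with le[of 0] have "s = 0" by (rule antisym)
    then show ?thesis by (auto simp: disjoint_complement_iff inf_absorb2)
  next
    case False
    then obtain d0 where d0: "d0 \<in> D" by blast
    have "inf \<bar>u\<bar> (pprt s) = 0" if u: "u \<in> S" for u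
    proof -
      define m where "m = inf \<bar>u\<bar> (pprt s)"
      have m: "0 \<le> m" "m \<le> \<bar>u\<bar>" "m \<le> pprt s" by (auto simp: m_def)
      have "d \<le> pprt s - m" if d: "d \<in> D" for d
      proof -
        have le: "pprt d \<le> \<bar>d\<bar>" by (simp add: pprt_def abs_ge_self)
        have "inf (pprt d) m \<le> inf \<bar>d\<bar> \<bar>u\<bar>" by (intro inf_mono le m)
        also have "\<dots> = 0"
          using subsetD[OF D d] u by (subst inf_commute) (simp add: disjoint_complement_iff)
        finally have "inf (pprt d) m = 0" using m(1) by (intro antisym) auto
        then have "pprt d + m = sup (pprt d) m" by (simp add: sup_eq_add_if_disjoint)
        also have "\<dots> \<le> pprt s" using m(3) up[OF d] by simp
        finally have "pprt d \<le> pprt s - m" by (simp add: le_diff_eq)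
        then show ?thesis by (rule order_trans[rotated]) (simp add: pprt_def)
      qed
      then have "s \<le> pprt s - m" by (rule least)
      moreover have "0 \<le> pprt s - m" using m by simp
      ultimately have "pprt s \<le> pprt s - m" by (simp add: pprt_def)
      then have "m \<le> 0" by simp
      then show ?thesis using m(1) by (simp add: m_def antisym)
    qed
    then have "pprt s \<in> disjoint_complement S" by (auto simp: disjoint_complement_iff)
    moreover have "\<bar>d0\<bar> \<in> disjoint_complement S"
      using D d0 by (auto simp: disjoint_complement_iff)
    ultimately have "pprt s + \<bar>d0\<bar> \<in> disjoint_complement S"
      using ideal by (simp add: lattice_ideal_def subspace_def)
    moreover have "\<bar>s\<bar> \<le> pprt s + \<bar>d0\<bar>"
    proof (rule abs_leI)
      show "s \<le> pprt s + \<bar>d0\<bar>" by (intro add_increasing2) (auto simp: pprt_def)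
      have "- s \<le> - d0" using up[OF d0] by simp
      also have "\<dots> \<le> \<bar>d0\<bar>" by (rule abs_ge_minus_self)
      also have "\<dots> \<le> pprt s + \<bar>d0\<bar>" by simp
      finally show "- s \<le> pprt s + \<bar>d0\<bar>" .
    qed
    ultimately show ?thesis
      using ideal by (metis lattice_idealD abs_ge_self order_trans)
  qed
qed

lemma disjoint_complement_Int_eq_0:
  fixes v :: "'a::banach_lattice"
  assumes "v \<in> B" "v \<in> disjoint_complement B"
  shows "v = 0"
  using assms by (auto simp: disjoint_complement_iff)

lemma pprt_disjoint_nprt:
  fixes w :: "'a::banach_lattice"
  shows "inf (pprt w) (pprt (- w)) = 0"
proof -
  have "inf (pprt w) (pprt (- w)) = pprt (- w) + inf (pprt w - pprt (- w)) 0"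
    by (simp add: add_inf_distrib_left)
  also have "pprt w - pprt (- w) = w" using prts[of w] by (simp add: pprt_neg)
  also have "inf w 0 = - pprt (- w)" by (simp add: pprt_neg nprt_def)
  finally show ?thesis by simp
qed

text \<open>The negative part of each summand lies below its own modulus and below that of the other
  one.\<close>

lemma nonneg_if_disjoint_sum_nonneg:
  fixes a b :: "'a::banach_lattice"
  assumes "inf \<bar>a\<bar> \<bar>b\<bar> = 0" "0 \<le> a + b"
  shows "0 \<le> a" "0 \<le> b"
proof -
  have "- a \<le> b" "- b \<le> a"
    using add_left_mono[OF assms(2), of "- a"] add_right_mono[OF assms(2), of "- b"]
    by (simp_all add: add.assoc)
  then have "- a \<le> inf \<bar>a\<bar> \<bar>b\<bar>" "- b \<le> inf \<bar>a\<bar> \<bar>b\<bar>"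
    by (meson abs_ge_minus_self abs_ge_self le_infI order_trans)+
  then show "0 \<le> a" "0 \<le> b" unfolding assms(1) neg_le_0_iff_le .
qed

section \<open>Splitting off a disjoint vector\<close>

lemma vector_sublatticeI:
  fixes Y :: "'a::banach_lattice set"
  assumes "subspace Y" "\<And>y. y \<in> Y \<Longrightarrow> sup y 0 \<in> Y"
  shows "vector_sublattice Y"
  unfolding vector_sublattice_def
proof (intro conjI ballI)
  show "subspace Y" by fact
  fix x y assume xy: "x \<in> Y" "y \<in> Y"
  have "sup x y = y + sup (x - y) 0" by (simp add: add_sup_distrib_left)
  then show s: "sup x y \<in> Y"
    using xy assms by (simp add: subspace_add subspace_diff)
  have "inf x y = x + y - sup x y"
    unfolding add_eq_inf_sup[of x y] by (rule add_diff_cancel_left'[symmetric])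
  then show "inf x y \<in> Y"
    using subspace_diff[OF assms(1) subspace_add[OF assms(1) xy] s] by (simp only:)
qed

lemma vector_sublattice_span: "vector_sublattice Y \<Longrightarrow> span Y = Y"
  by (simp add: vector_sublattice_def span_eq_iff)

lemma vector_sublattice_abs:
  assumes "vector_sublattice Y" "y \<in> Y"
  shows "\<bar>y\<bar> \<in> Y"
  using assms by (simp add: vector_sublattice_def abs_lattice subspace_neg)

lemma vector_sublattice_pprt:
  assumes "vector_sublattice Y" "y \<in> Y"
  shows "pprt y \<in> Y"
  using assms by (simp add: vector_sublattice_def pprt_def subspace_0)

text \<open>Disjointness makes the lattice operations act componentwise on sums: in the bound
  \<open>pprt a \<le> pprt (a + b) + pprt (- b)\<close> the last term is disjoint from \<open>pprt a\<close>.\<close>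

lemma pprt_le_pprt_add_if_disjoint:
  fixes a b :: "'a::banach_lattice"
  assumes "inf \<bar>a\<bar> \<bar>b\<bar> = 0"
  shows "pprt a \<le> pprt (a + b)"
proof -
  have "a + b \<le> pprt (a + b)" "- b \<le> pprt (- b)" by (auto simp: pprt_def)
  then have "(a + b) + (- b) \<le> pprt (a + b) + pprt (- b)" by (rule add_mono)
  then have "pprt a \<le> pprt (a + b) + pprt (- b)" by (simp add: pprt_def[of a])
  then have "pprt a \<le> inf (pprt a) (pprt (a + b) + pprt (- b))" by simp
  also have "\<dots> \<le> inf (pprt a) (pprt (a + b)) + inf (pprt a) (pprt (- b))"
    by (intro inf_add_le) auto
  also have "\<dots> \<le> pprt (a + b) + inf \<bar>a\<bar> \<bar>b\<bar>"
  proof (intro add_mono inf_mono)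
    show "pprt a \<le> \<bar>a\<bar>" "pprt (- b) \<le> \<bar>b\<bar>" by (auto simp: pprt_def abs_ge_self abs_ge_minus_self)
  qed auto
  finally show ?thesis using assms by simp
qed

lemma pprt_add_disjoint:
  fixes a b :: "'a::banach_lattice"
  assumes "inf \<bar>a\<bar> \<bar>b\<bar> = 0"
  shows "pprt (a + b) = pprt a + pprt b"
proof (rule antisym)
  have "a + b \<le> pprt a + pprt b" by (intro add_mono) (auto simp: pprt_def)
  then show "pprt (a + b) \<le> pprt a + pprt b" by (simp add: pprt_def[of "a + b"])
  have "inf (pprt a) (pprt b) \<le> inf \<bar>a\<bar> \<bar>b\<bar>"
    by (intro inf_mono) (auto simp: pprt_def abs_ge_self)
  then have "inf (pprt a) (pprt b) = 0" using assms by (simp add: antisym)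
  then have "pprt a + pprt b = sup (pprt a) (pprt b)" by (simp add: sup_eq_add_if_disjoint)
  also have "\<dots> \<le> pprt (a + b)"
    using pprt_le_pprt_add_if_disjoint[OF assms] pprt_le_pprt_add_if_disjoint[of b a] assms
    by (simp add: inf_commute add.commute)
  finally show "pprt a + pprt b \<le> pprt (a + b)" .
qed

lemma pprt_scaleR_nonneg:
  fixes q :: "'a::banach_lattice"
  assumes "0 \<le> q"
  shows "pprt (k *\<^sub>R q) = max k 0 *\<^sub>R q"
  using assms
  by (cases "0 \<le> k") (auto simp: max_def scaleR_nonneg_nonneg scaleR_nonpos_nonneg)

lemma vector_sublattice_insert_disjoint:
  fixes Y :: "'a::banach_lattice set"
  assumes Y: "vector_sublattice Y" and q: "0 \<le> q" "q \<in> disjoint_complement Y"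
  shows "vector_sublattice (span (insert q Y))"
proof (rule vector_sublatticeI)
  show "subspace (span (insert q Y))" by (rule subspace_span)
  fix z assume "z \<in> span (insert q Y)"
  then obtain k where "z - k *\<^sub>R q \<in> span Y" by (auto simp: span_insert)
  then have y: "z - k *\<^sub>R q \<in> Y"
    using vector_sublattice_span[OF Y] by simp
  have "k *\<^sub>R q \<in> disjoint_complement Y"
    using lattice_ideal_disjoint_complement[of Y] q(2)
    by (simp add: lattice_ideal_def subspace_scale)
  then have "inf \<bar>z - k *\<^sub>R q\<bar> \<bar>k *\<^sub>R q\<bar> = 0" using y by (auto simp: disjoint_complement_iff)
  from pprt_add_disjoint[OF this] have "pprt z = pprt (z - k *\<^sub>R q) + max k 0 *\<^sub>R q"
    using q(1) by (simp add: pprt_scaleR_nonneg)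
  moreover have "pprt (z - k *\<^sub>R q) \<in> span (insert q Y)"
    using vector_sublattice_pprt[OF Y y] by (auto intro: span_base)
  ultimately show "sup z 0 \<in> span (insert q Y)"
    by (auto simp: pprt_def[of z] intro: span_add span_scale span_base)
qed

lemma span_insert_span:
  fixes q :: "'a::real_vector"
  shows "span (insert q (span B)) = span (insert q B)"
  by (simp add: set_eq_iff span_breakdown_eq span_span)

lemma finite_dimensional_insert:
  assumes "finite_dimensional Y"
  shows "finite_dimensional (span (insert q Y))"
proof -
  obtain B where "finite B" and B: "span B = Y"
    using assms by (auto simp: finite_dimensional_def)
  have "span (insert q B) = span (insert q Y)"
    unfolding B[symmetric] by (rule span_insert_span[symmetric])
  with \<open>finite B\<close> show ?thesis
    unfolding finite_dimensional_def by (intro exI[of _ "insert q B"]) auto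
qed

lemma zero_sublattice:
  "vector_sublattice {0::'a::banach_lattice}" "finite_dimensional {0::'a}"
  by (auto simp: vector_sublattice_def finite_dimensional_def subspace_def intro!: exI[of _ "{}"])

lemma line_sublattice:
  fixes e :: "'a::banach_lattice"
  assumes "0 \<le> e"
  shows "vector_sublattice (span {e})" "finite_dimensional (span {e})"
proof -
  have "e \<in> disjoint_complement {0}" by (auto simp: disjoint_complement_iff inf_absorb1)
  moreover have "span (insert e {0}) = span {e}" by (simp add: insert_commute)
  ultimately show "vector_sublattice (span {e})" "finite_dimensional (span {e})"
    using vector_sublattice_insert_disjoint[OF zero_sublattice(1) assms]
      finite_dimensional_insert[OF zero_sublattice(2), of e] by auto
qed

section \<open>Freudenthal approximation\<close>

text \<open>Let \<open>w = x - \<delta> e\<close>. The band generated by the positive part of \<open>w\<close> is disjoint from the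
  negative part, because the disjoint complement of the latter is itself a band and contains the
  former. Comparing the
  components of \<open>w = pprt w - pprt (- w)\<close> with those of \<open>(a - \<delta> p) + (b - \<delta> q)\<close> gives the sign conditions.\<close>

lemma band_splitting:
  fixes x e :: "'a::banach_lattice"
  assumes ppp: "principal_projection_property TYPE('a)"
    and "0 \<le> x" "0 \<le> e"
  obtains B p q a b where
    "lattice_ideal B" "p \<in> B" "a \<in> B" "q \<in> disjoint_complement B" "b \<in> disjoint_complement B"
    "e = p + q" "x = a + b" "0 \<le> p" "0 \<le> q" "0 \<le> a" "0 \<le> b"
    "\<delta> *\<^sub>R p \<le> a" "b \<le> \<delta> *\<^sub>R q"
proof -
  define w where "w = x - \<delta> *\<^sub>R e"
  define u where "u = pprt w"
  define v where "v = pprt (- w)"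
  define B where "B = principal_band u"
  have "projection_band B"
    using ppp by (simp add: principal_projection_property_def B_def)
  then have B: "lattice_ideal B"
    and dec: "\<And>z. \<exists>c\<in>B. \<exists>d\<in>disjoint_complement B. z = c + d"
    by (auto simp: projection_band_def band_def)
  have sB: "subspace B" and sC: "subspace (disjoint_complement B)"
    using B lattice_ideal_disjoint_complement[of B] by (auto simp: lattice_ideal_def)
  have u: "u \<in> B" by (auto simp: B_def principal_band_def)
  have "inf u v = 0" unfolding u_def v_def by (rule pprt_disjoint_nprt)
  then have "u \<in> disjoint_complement {v}"
    by (auto simp: disjoint_complement_iff inf_commute u_def v_def)
  then have "B \<subseteq> disjoint_complement {v}"
    using band_disjoint_complement[of "{v}"] by (auto simp: B_def principal_band_def)
  then have v: "v \<in> disjoint_complement B"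
    by (auto simp: disjoint_complement_iff inf_commute)
  obtain p q where pq: "p \<in> B" "q \<in> disjoint_complement B" "e = p + q" using dec by blast
  obtain a b where ab: "a \<in> B" "b \<in> disjoint_complement B" "x = a + b" using dec by blast
  have "inf \<bar>p\<bar> \<bar>q\<bar> = 0" "inf \<bar>a\<bar> \<bar>b\<bar> = 0"
    using pq ab by (auto simp: disjoint_complement_iff)
  then have nonneg: "0 \<le> p" "0 \<le> q" "0 \<le> a" "0 \<le> b"
    using nonneg_if_disjoint_sum_nonneg assms(2,3) unfolding pq(3) ab(3) by blast+
  have "u - v = w" unfolding u_def v_def pprt_neg diff_minus_eq_add by (rule prts[symmetric])
  also have "w = (a - \<delta> *\<^sub>R p) - (\<delta> *\<^sub>R q - b)"
    unfolding w_def pq(3) ab(3) by (simp add: algebra_simps)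
  finally have eq: "a - \<delta> *\<^sub>R p - u = \<delta> *\<^sub>R q - b - v" by (simp add: algebra_simps)
  moreover have "a - \<delta> *\<^sub>R p - u \<in> B"
    using sB ab pq u by (simp add: subspace_diff subspace_scale)
  moreover have "\<delta> *\<^sub>R q - b - v \<in> disjoint_complement B"
    using sC ab pq v by (simp add: subspace_diff subspace_scale)
  ultimately have "a - \<delta> *\<^sub>R p - u = 0" by (intro disjoint_complement_Int_eq_0) simp_all
  with eq have "a - \<delta> *\<^sub>R p = u" "\<delta> *\<^sub>R q - b = v" by auto
  moreover have "0 \<le> u" "0 \<le> v" by (auto simp: u_def v_def)
  ultimately have "0 \<le> a - \<delta> *\<^sub>R p" "0 \<le> \<delta> *\<^sub>R q - b" by simp_all
  then have "\<delta> *\<^sub>R p \<le> a" "b \<le> \<delta> *\<^sub>R q" unfolding diff_ge_0_iff_ge .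
  with that[OF B pq(1) ab(1) pq(2) ab(2) pq(3) ab(3) nonneg] show ?thesis .
qed

text \<open>The clause that \<open>Y\<close> lies in the ideal generated by \<open>e\<close> is what makes the induction work: the
  sublattice obtained for the component \<open>p\<close> is then disjoint from the complementary component
  \<open>q\<close>, which can therefore be adjoined.\<close>

lemma freudenthal_finite_dimensional:
  fixes x e :: "'a::banach_lattice"
  assumes ppp: "principal_projection_property TYPE('a)"
    and "0 \<le> x" "0 \<le> e" "x \<le> (real n * \<delta>) *\<^sub>R e" "0 \<le> \<delta>"
  shows "\<exists>Y x'. vector_sublattice Y \<and> finite_dimensional Y \<and> e \<in> Y \<and>
           (\<forall>y\<in>Y. \<exists>c. \<bar>y\<bar> \<le> c *\<^sub>R e) \<and> x' \<in> Y \<and> 0 \<le> x' \<and> x' \<le> x \<and> x \<le> x' + \<delta> *\<^sub>R e"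
  using assms(2-4)
proof (induction n arbitrary: x e)
  case 0
  then have "x = 0" by (simp add: antisym)
  have "\<exists>c. \<bar>y\<bar> \<le> c *\<^sub>R e" if y: "y \<in> span {e}" for y
  proof -
    obtain k where "y = k *\<^sub>R e" using y by (auto simp: span_singleton)
    then show ?thesis using abs_scaleR_le[of k e] 0 by auto
  qed
  then show ?case
    using \<open>x = 0\<close> line_sublattice[of e] 0 \<open>0 \<le> \<delta>\<close>
    by (intro exI[of _ "span {e}"] exI[of _ 0])
      (auto intro: span_base span_zero simp: scaleR_nonneg_nonneg)
next
  case (Suc n)
  obtain B p q a b where B: "lattice_ideal B"
    and mem: "p \<in> B" "a \<in> B" "q \<in> disjoint_complement B" "b \<in> disjoint_complement B"
    and sum: "e = p + q" "x = a + b" and nonneg: "0 \<le> p" "0 \<le> q" "0 \<le> a" "0 \<le> b"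
    and level: "\<delta> *\<^sub>R p \<le> a" "b \<le> \<delta> *\<^sub>R q"
    using band_splitting[OF ppp Suc.prems(1,2)] .
  let ?r = "real (Suc n) * \<delta>"
  have "a \<le> ?r *\<^sub>R p"
  proof -
    have "?r *\<^sub>R p - a \<in> B"
      using B mem by (simp add: lattice_ideal_def subspace_diff subspace_scale)
    moreover have "?r *\<^sub>R q - b \<in> disjoint_complement B"
      using lattice_ideal_disjoint_complement[of B] mem
      by (simp add: lattice_ideal_def subspace_diff subspace_scale)
    ultimately have "inf \<bar>?r *\<^sub>R p - a\<bar> \<bar>?r *\<^sub>R q - b\<bar> = 0"
      by (auto simp: disjoint_complement_iff)
    moreover have "0 \<le> (?r *\<^sub>R p - a) + (?r *\<^sub>R q - b)"
    proof -
      have "(?r *\<^sub>R p - a) + (?r *\<^sub>R q - b) = ?r *\<^sub>R e - x"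
        unfolding sum scaleR_add_right by simp
      then show ?thesis using Suc.prems(3) by simp
    qed
    ultimately have "0 \<le> ?r *\<^sub>R p - a" by (rule nonneg_if_disjoint_sum_nonneg(1))
    then show ?thesis by simp
  qed
  then have "a - \<delta> *\<^sub>R p \<le> (real n * \<delta>) *\<^sub>R p"
    by (simp add: algebra_simps)
  moreover have "0 \<le> a - \<delta> *\<^sub>R p" using level by simp
  ultimately obtain Y x' where Y: "vector_sublattice Y" "finite_dimensional Y" "p \<in> Y"
    and dom: "\<And>y. y \<in> Y \<Longrightarrow> \<exists>c. \<bar>y\<bar> \<le> c *\<^sub>R p"
    and x': "x' \<in> Y" "0 \<le> x'" "x' \<le> a - \<delta> *\<^sub>R p" "a - \<delta> *\<^sub>R p \<le> x' + \<delta> *\<^sub>R p"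
    using Suc.IH[of "a - \<delta> *\<^sub>R p" p] nonneg by blast
  have "Y \<subseteq> B"
  proof
    fix y assume "y \<in> Y"
    then obtain c where "\<bar>y\<bar> \<le> c *\<^sub>R p" using dom by blast
    also have "\<dots> \<le> \<bar>c *\<^sub>R p\<bar>" by (rule abs_ge_self)
    finally show "y \<in> B"
      using B mem(1) lattice_idealD[OF B, of "c *\<^sub>R p" y]
      by (simp add: lattice_ideal_def subspace_scale)
  qed
  then have q: "q \<in> disjoint_complement Y" using mem(3) by (auto simp: disjoint_complement_iff)
  let ?Z = "span (insert q Y)"
  have p: "p \<in> ?Z" "q \<in> ?Z" "x' \<in> ?Z" using Y x' by (auto intro: span_base)
  have "\<exists>c. \<bar>z\<bar> \<le> c *\<^sub>R e" if z: "z \<in> ?Z" for z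
  proof -
    obtain k where "z - k *\<^sub>R q \<in> span Y" using z by (auto simp: span_insert)
    then have "z - k *\<^sub>R q \<in> Y" using vector_sublattice_span[OF Y(1)] by simp
    then obtain c where c: "\<bar>z - k *\<^sub>R q\<bar> \<le> c *\<^sub>R p" using dom by blast
    have "\<bar>z\<bar> = \<bar>(z - k *\<^sub>R q) + k *\<^sub>R q\<bar>" by simp
    also have "\<dots> \<le> \<bar>z - k *\<^sub>R q\<bar> + \<bar>k *\<^sub>R q\<bar>" by (rule abs_triangle_ineq)
    also have "\<dots> \<le> c *\<^sub>R p + \<bar>k\<bar> *\<^sub>R q"
      using c abs_scaleR_le[of k q] nonneg by (intro add_mono) auto
    also have "\<dots> \<le> max c \<bar>k\<bar> *\<^sub>R p + max c \<bar>k\<bar> *\<^sub>R q"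
      using nonneg by (intro add_mono scaleR_right_mono) auto
    also have "\<dots> = max c \<bar>k\<bar> *\<^sub>R e" by (simp add: sum scaleR_add_right)
    finally show ?thesis by blast
  qed
  moreover have "x' + \<delta> *\<^sub>R p \<le> x"
    using x'(3) nonneg(4) by (simp add: sum le_diff_eq add_increasing2)
  moreover have "x \<le> (x' + \<delta> *\<^sub>R p) + \<delta> *\<^sub>R e"
    using add_mono[OF x'(4) level(2)] unfolding sum by (simp add: algebra_simps)
  moreover have "0 \<le> x' + \<delta> *\<^sub>R p"
    using x' nonneg \<open>0 \<le> \<delta>\<close> by (simp add: scaleR_nonneg_nonneg)
  moreover have "e \<in> ?Z" "x' + \<delta> *\<^sub>R p \<in> ?Z"
    using p by (auto simp: sum intro: span_add span_scale)
  ultimately show ?case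
    using vector_sublattice_insert_disjoint[OF Y(1) nonneg(2) q]
      finite_dimensional_insert[OF Y(2), of q] by blast
qed

section \<open>Pairs of points of the positive sphere\<close>

lemma normalized_mem_pos_sphere:
  fixes x :: "'a::banach_lattice"
  assumes "vector_sublattice Y" "x \<in> Y" "0 \<le> x" "x \<noteq> 0"
  shows "x /\<^sub>R norm x \<in> pos_sphere Y"
  using assms by (simp add: pos_sphere_def vector_sublattice_def subspace_scale
      scaleR_nonneg_nonneg)

lemma pos_sphere_nonempty:
  fixes Y :: "'a::banach_lattice set"
  assumes "vector_sublattice Y" "Y \<noteq> {0}"
  shows "pos_sphere Y \<noteq> {}"
proof -
  have "0 \<in> Y" using assms by (simp add: vector_sublattice_def subspace_0)
  then obtain y where "y \<in> Y" "y \<noteq> 0" using assms by auto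
  then show ?thesis
    using normalized_mem_pos_sphere[OF assms(1) vector_sublattice_abs[OF assms(1)], of y] by auto
qed

text \<open>Normalising a positive vector whose norm is almost \<open>1\<close> moves it by no more than the defect of
  its norm.\<close>

lemma norm_normalized_diff_le:
  fixes x x' :: "'a::banach_lattice"
  assumes "norm x = 1" "norm (x - x') \<le> d" "x' \<noteq> 0"
  shows "norm (x' /\<^sub>R norm x' - x) \<le> 2 * d"
proof -
  have "x' /\<^sub>R norm x' - x' = (inverse (norm x') - 1) *\<^sub>R x'" by (simp add: scaleR_diff_left)
  then have "norm (x' /\<^sub>R norm x' - x') = \<bar>inverse (norm x') - 1\<bar> * \<bar>norm x'\<bar>" by simp
  also have "\<dots> = \<bar>1 - norm x'\<bar>"
    unfolding abs_mult[symmetric] left_diff_distrib using assms(3) by simp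
  also have "\<dots> \<le> d"
    using assms(1,2) norm_triangle_ineq3[of x x'] by simp
  finally have "norm (x' /\<^sub>R norm x' - x') \<le> d" .
  moreover have "norm (x' - x) \<le> d" using assms(2) by (simp add: norm_minus_commute)
  ultimately show ?thesis
    using norm_triangle_ineq[of "x' /\<^sub>R norm x' - x'" "x' - x"] by simp
qed

lemma pos_sphere_pair_approximation:
  fixes x y :: "'a::banach_lattice"
  assumes ppp: "principal_projection_property TYPE('a)"
    and x: "0 \<le> x" "norm x = 1" and y: "0 \<le> y" "norm y = 1" and "0 < \<epsilon>"
  obtains Y x' y' where "vector_sublattice Y" "finite_dimensional Y"
    "x' \<in> pos_sphere Y" "y' \<in> pos_sphere Y" "norm (x' - x) \<le> \<epsilon>" "norm (y' - y) \<le> \<epsilon>"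
proof -
  \<comment> \<open>The summand \<open>2\<close> keeps \<open>2 / n\<close> below \<open>1\<close>, so that the approximants do not vanish and can be
    normalised.\<close>
  obtain n :: nat where n: "2 + 4 / \<epsilon> < real n" using reals_Archimedean2 by blast
  define \<delta> where "\<delta> = 1 / real n"
  have n2: "2 < real n" "4 / \<epsilon> < real n"
    using n \<open>0 < \<epsilon>\<close> divide_pos_pos[of 4 \<epsilon>] by linarith+
  then have \<delta>: "0 < \<delta>" "4 * \<delta> \<le> \<epsilon>" "real n * \<delta> = 1" "2 * \<delta> < 1"
    using \<open>0 < \<epsilon>\<close> by (auto simp: \<delta>_def field_simps)
  define e where "e = x + y"
  have e: "0 \<le> e" "norm e \<le> 2"
    using x y norm_triangle_ineq[of x y] by (auto simp: e_def)
  have "x \<le> (real n * \<delta>) *\<^sub>R e" using y by (simp add: e_def \<delta>)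
  then obtain Y x1 where Y: "vector_sublattice Y" "finite_dimensional Y" "e \<in> Y" "x1 \<in> Y"
    and x1: "0 \<le> x1" "x1 \<le> x" "x \<le> x1 + \<delta> *\<^sub>R e"
    using freudenthal_finite_dimensional[OF ppp x(1) e(1)] \<delta>(1) by (meson less_imp_le)
  define y1 where "y1 = e - x1"
  have y1: "y1 \<in> Y" using Y by (simp add: y1_def vector_sublattice_def subspace_diff)
  have "0 \<le> e - x1" using x1(2) y(1) by (simp add: e_def add_increasing2)
  then have y1_nonneg: "0 \<le> y1" by (simp add: y1_def)
  have "norm (x - x1) \<le> norm (\<delta> *\<^sub>R e)"
    using x1 by (intro norm_mono_nonneg) (auto simp: diff_le_eq add.commute)
  also have "\<dots> \<le> 2 * \<delta>" using e(2) \<delta>(1) by simp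
  finally have dx: "norm (x - x1) \<le> 2 * \<delta>" .
  have "y - y1 = - (x - x1)" by (simp add: y1_def e_def)
  then have dy: "norm (y - y1) \<le> 2 * \<delta>" using dx by (metis norm_minus_cancel)
  have nz: "x1 \<noteq> 0" "y1 \<noteq> 0" using dx dy x y \<delta>(4) by auto
  have "norm (x1 /\<^sub>R norm x1 - x) \<le> \<epsilon>" "norm (y1 /\<^sub>R norm y1 - y) \<le> \<epsilon>"
    using norm_normalized_diff_le[OF x(2) dx nz(1)] norm_normalized_diff_le[OF y(2) dy nz(2)]
      \<delta>(2) by auto
  then show thesis
    using that[OF Y(1,2) normalized_mem_pos_sphere[OF Y(1) Y(4) x1(1) nz(1)]
      normalized_mem_pos_sphere[OF Y(1) y1 y1_nonneg nz(2)]] by blast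
qed

text \<open>A sublattice without disjoint pairs is totally ordered, because the positive and the negative
  part of an element are disjoint. If \<open>a\<close> is a positive unit vector and \<open>c\<close> the supremum of the
  \<open>t\<close> with \<open>t a \<le> b\<close>, then \<open>b\<close> lies between \<open>(c - \<epsilon>) a\<close> and \<open>(c + \<epsilon>) a\<close> for every
  \<open>\<epsilon> > 0\<close>, so \<open>b = c a\<close>.\<close>

lemma exists_disjoint_pair:
  fixes Y :: "'a::banach_lattice set"
  assumes Y: "vector_sublattice Y" and not_line: "\<nexists>a. Y \<subseteq> span {a}"
  shows "\<exists>x\<in>pos_sphere Y. \<exists>y\<in>pos_sphere Y. inf x y = 0"
proof (rule ccontr)
  assume none: "\<not> ?thesis"
  have sub: "subspace Y" using Y by (simp add: vector_sublattice_def)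
  have total: "w \<le> 0 \<or> 0 \<le> w" if w: "w \<in> Y" for w
  proof (rule ccontr)
    assume "\<not> ?thesis"
    then have nz: "pprt w \<noteq> 0" "pprt (- w) \<noteq> 0"
      using le_zero_iff_zero_pprt[of w] le_zero_iff_zero_pprt[of "- w"] by auto
    let ?p = "pprt w" and ?m = "pprt (- w)"
    have mem: "?p \<in> Y" "?m \<in> Y"
      using vector_sublattice_pprt[OF Y] w sub by (auto simp: subspace_neg)
    have "inf ?p (?m /\<^sub>R norm ?m) = 0"
      by (intro inf_scaleR_eq_0) (auto simp: pprt_disjoint_nprt)
    then have "inf (?m /\<^sub>R norm ?m) (?p /\<^sub>R norm ?p) = 0"
      by (intro inf_scaleR_eq_0) (auto simp: inf_commute scaleR_nonneg_nonneg)
    then show False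
      using none normalized_mem_pos_sphere[OF Y mem(1) _ nz(1)]
        normalized_mem_pos_sphere[OF Y mem(2) _ nz(2)] by auto
  qed
  have "Y \<noteq> {0}" using not_line by (auto simp: span_zero)
  then obtain a where a: "a \<in> Y" "0 \<le> a" "norm a = 1"
    using pos_sphere_nonempty[OF Y] by (auto simp: pos_sphere_def)
  have "b \<in> span {a}" if b: "b \<in> Y" for b
  proof -
    have compare: "t *\<^sub>R a \<le> b \<or> b \<le> t *\<^sub>R a" for t
      using total[of "t *\<^sub>R a - b"] sub a b by (simp add: subspace_diff subspace_scale)
    define M where "M = norm b + 1"
    have too_big: "\<not> M *\<^sub>R a \<le> c" if "norm c = norm b" for c
    proof
      assume "M *\<^sub>R a \<le> c"
      then have "norm (M *\<^sub>R a) \<le> norm c"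
        using a by (intro norm_mono_nonneg) (auto simp: M_def scaleR_nonneg_nonneg)
      then show False using a that by (simp add: M_def)
    qed
    define T where "T = {t. t *\<^sub>R a \<le> b}"
    have "t \<le> M" if "t \<in> T" for t
      using that too_big[of b] scaleR_right_mono[of M t a] a
      by (auto simp: T_def intro: order_trans)
    then have bdd: "bdd_above T" by (auto simp: bdd_above_def)
    have "- M \<in> T"
    proof -
      have "\<not> b \<le> - (M *\<^sub>R a)"
      proof
        assume "b \<le> - (M *\<^sub>R a)"
        then have "M *\<^sub>R a \<le> - b" by (rule iffD1[OF le_minus_iff])
        then show False using too_big[OF norm_minus_cancel] by blast
      qed
      then show ?thesis using compare[of "- M"] by (auto simp: T_def)
    qed
    then have ne: "T \<noteq> {}" by auto
    define c where "c = Sup T"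
    have "norm (b - c *\<^sub>R a) \<le> \<epsilon>" if "0 < \<epsilon>" for \<epsilon>
    proof -
      have "\<exists>t\<in>T. c - \<epsilon> < t"
        using that unfolding less_cSup_iff[OF ne bdd, symmetric] c_def[symmetric] by simp
      then obtain t where t: "t *\<^sub>R a \<le> b" "c - \<epsilon> < t" by (auto simp: T_def)
      have "(c - \<epsilon>) *\<^sub>R a \<le> t *\<^sub>R a" using t(2) a(2) by (intro scaleR_right_mono) auto
      then have lower: "(c - \<epsilon>) *\<^sub>R a \<le> b" using t(1) by (rule order_trans)
      have "c + \<epsilon> \<notin> T" using cSup_upper[OF _ bdd] that by (force simp: c_def)
      then have upper: "b \<le> (c + \<epsilon>) *\<^sub>R a" using compare by (auto simp: T_def)
      have "\<bar>b - c *\<^sub>R a\<bar> \<le> \<epsilon> *\<^sub>R a"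
        using lower upper by (intro abs_leI) (auto simp: algebra_simps)
      then have "norm (b - c *\<^sub>R a) \<le> norm (\<epsilon> *\<^sub>R a)" by (rule norm_le_of_abs_le)
      then show ?thesis using a that by simp
    qed
    then have "norm (b - c *\<^sub>R a) \<le> 0" by (rule dense_ge)
    then have "b = c *\<^sub>R a" by simp
    then show ?thesis by (simp add: span_scale span_base)
  qed
  then have "Y \<subseteq> span {a}" by (rule subsetI)
  then show False using not_line by (simp only: not_ex)
qed

lemma disjoint_pair_span:
  fixes x y :: "'a::banach_lattice"
  assumes x: "x \<in> pos_sphere UNIV" and y: "y \<in> pos_sphere UNIV" and disj: "inf x y = 0"
  shows "vector_sublattice (span {x, y})" "finite_dimensional (span {x, y})"
    "dim (span {x, y}) = 2"
proof -
  have nonneg: "0 \<le> x" "0 \<le> y" and nz: "x \<noteq> 0" "y \<noteq> 0"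
    using x y by (auto simp: pos_sphere_def)
  have "y \<in> disjoint_complement {x}"
    using nonneg disj by (auto simp: disjoint_complement_iff)
  then have "x \<in> disjoint_complement {y}"
    by (auto simp: disjoint_complement_iff inf_commute)
  then have "span {x} \<subseteq> disjoint_complement {y}"
    using lattice_ideal_disjoint_complement[of "{y}"]
    by (intro span_minimal) (auto simp: lattice_ideal_def)
  then have y_disj: "y \<in> disjoint_complement (span {x})"
    by (auto simp: disjoint_complement_iff inf_commute)
  have "span {x, y} = span (insert y (span {x}))"
    unfolding span_insert_span insert_commute[of x y] ..
  then show "vector_sublattice (span {x, y})" "finite_dimensional (span {x, y})"
    using vector_sublattice_insert_disjoint[OF line_sublattice(1)[OF nonneg(1)] nonneg(2) y_disj]
      finite_dimensional_insert[OF line_sublattice(2)[OF nonneg(1)], of y] by auto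
  have "y \<notin> span {x}" using disjoint_complement_Int_eq_0[OF _ y_disj] nz by auto
  then have "independent {y, x}" and "x \<noteq> y"
    using nz by (auto simp: independent_insert intro: span_base)
  then show "dim (span {x, y}) = 2"
    by (simp add: insert_commute dim_eq_card_independent)
qed

lemma not_line_if_dim_at_least_2:
  fixes Y :: "'a::real_vector set"
  assumes "subspace Y" "dim_at_least 2 Y"
  shows "\<nexists>a. Y \<subseteq> span {a}"
proof
  assume "\<exists>a. Y \<subseteq> span {a}"
  then obtain a where a: "Y \<subseteq> span {a}" ..
  obtain B where B: "B \<subseteq> Y" "independent B" "Y \<subseteq> span B" using maximal_independent_subset by blast
  have "span B = Y" using B assms(1) by (simp add: span_minimal subset_antisym)
  moreover have "finite B"
    using B a independent_span_bound[of "{a}" B] by (meson finite.emptyI finite_insert subset_trans)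
  ultimately have "finite_dimensional Y" by (auto simp: finite_dimensional_def)
  then have "2 \<le> dim Y" using assms(2) by (simp add: dim_at_least_def)
  moreover have "dim Y \<le> 1" using dim_le_card[OF a] by simp
  ultimately show False by simp
qed

section \<open>Comparing infima\<close>

text \<open>The shape common to both identities: \<open>A Y\<close> is the set of values realised inside \<open>Y\<close>.\<close>

lemma Inf_exhausted_by_family:
  fixes A :: "'b \<Rightarrow> real set"
  assumes bdd: "\<And>s. s \<in> A X \<Longrightarrow> 0 \<le> s" and ne: "A X \<noteq> {}"
    and member: "\<And>Y. Y \<in> F \<Longrightarrow> A Y \<noteq> {} \<and> A Y \<subseteq> A X"
    and approx: "\<And>s \<epsilon>. s \<in> A X \<Longrightarrow> 0 < \<epsilon> \<Longrightarrow> \<exists>Y\<in>F. \<exists>t\<in>A Y. t \<le> s + \<epsilon>"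
  shows "Inf (A X) = Inf ((\<lambda>Y. Inf (A Y)) ` F)"
proof (rule antisym)
  have "bdd_below (A X)" by (rule bdd_belowI[OF bdd])
  then have le: "Inf (A X) \<le> Inf (A Y)" if "Y \<in> F" for Y
    using member[OF that] by (intro cInf_superset_mono) auto
  have "F \<noteq> {}" using ne approx[OF _ zero_less_one] by blast
  then show "Inf (A X) \<le> Inf ((\<lambda>Y. Inf (A Y)) ` F)" using le by (auto intro: cINF_greatest)
  have bddF: "bdd_below ((\<lambda>Y. Inf (A Y)) ` F)" using le by (rule bdd_belowI2)
  have "Inf ((\<lambda>Y. Inf (A Y)) ` F) \<le> s" if s: "s \<in> A X" for s
  proof (rule field_le_epsilon)
    fix \<epsilon> :: real assume "0 < \<epsilon>"
    then obtain Y t where Y: "Y \<in> F" "t \<in> A Y" "t \<le> s + \<epsilon>" using approx[OF s] by blast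
    have "bdd_below (A Y)" using member[OF Y(1)] bdd by (auto intro!: bdd_belowI[of _ 0])
    then have "Inf (A Y) \<le> t" using Y by (auto intro: cInf_lower)
    with cINF_lower[OF bddF Y(1)] Y(3) show "Inf ((\<lambda>Y. Inf (A Y)) ` F) \<le> s + \<epsilon>" by simp
  qed
  then show "Inf ((\<lambda>Y. Inf (A Y)) ` F) \<le> Inf (A X)" using ne by (auto intro: cInf_greatest)
qed

lemma vector_sublattice_UNIV: "vector_sublattice (UNIV :: 'a::banach_lattice set)"
  by (simp add: vector_sublattice_def)

theorem proposition4p1:
  assumes "dim_at_least 2 (UNIV :: 'a::banach_lattice set)"
    and "principal_projection_property TYPE('a)"
  shows "lattice_schaeffer (UNIV :: 'a set) =
           Inf {lattice_schaeffer Y | Y :: 'a set.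
                  vector_sublattice Y \<and> finite_dimensional Y \<and> Y \<noteq> {0}} \<and>
         beta (UNIV :: 'a set) =
           Inf {beta Y | Y :: 'a set.
                  vector_sublattice Y \<and> finite_dimensional Y \<and> 2 \<le> dim Y}"
proof
  have not_line: "\<nexists>a. (UNIV :: 'a set) \<subseteq> span {a}"
    using not_line_if_dim_at_least_2[OF subspace_UNIV assms(1)] .
  have disjoint_pair: "\<exists>x\<in>pos_sphere (UNIV :: 'a set). \<exists>y\<in>pos_sphere UNIV. inf x y = 0"
    using exists_disjoint_pair[OF vector_sublattice_UNIV not_line] .

  define L :: "'a set \<Rightarrow> real set" where
    "L = (\<lambda>Y. {max (norm (x - y)) (norm (x + y)) | x y. x \<in> pos_sphere Y \<and> y \<in> pos_sphere Y})"
  define F :: "'a set set" where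
    "F = {Y. vector_sublattice Y \<and> finite_dimensional Y \<and> Y \<noteq> {0}}"
  have "Inf (L UNIV) = Inf ((\<lambda>Y. Inf (L Y)) ` F)"
  proof (rule Inf_exhausted_by_family)
    show "0 \<le> s" if "s \<in> L UNIV" for s using that by (auto simp: L_def le_max_iff_disj)
    show "L UNIV \<noteq> {}" using disjoint_pair by (auto simp: L_def)
    show "L Y \<noteq> {} \<and> L Y \<subseteq> L UNIV" if "Y \<in> F" for Y
      using that pos_sphere_nonempty[of Y] by (auto simp: L_def F_def pos_sphere_def; blast)
    show "\<exists>Y\<in>F. \<exists>t\<in>L Y. t \<le> s + \<epsilon>" if s: "s \<in> L UNIV" and "0 < \<epsilon>" for s \<epsilon>
    proof -
      obtain x y :: 'a where "x \<in> pos_sphere UNIV" "y \<in> pos_sphere UNIV"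
        and s_eq: "s = max (norm (x - y)) (norm (x + y))"
        using s unfolding L_def by blast
      then have x: "0 \<le> x" "norm x = 1" and y: "0 \<le> y" "norm y = 1"
        by (simp_all add: pos_sphere_def)
      obtain Y x' y' where Y: "vector_sublattice Y" "finite_dimensional Y"
        and mem: "x' \<in> pos_sphere Y" "y' \<in> pos_sphere Y"
        and close: "norm (x' - x) \<le> \<epsilon> / 2" "norm (y' - y) \<le> \<epsilon> / 2"
        using pos_sphere_pair_approximation[OF assms(2) x y, of "\<epsilon> / 2"] \<open>0 < \<epsilon>\<close> by auto
      have "norm (x' - y') \<le> norm (x - y) + \<epsilon>" "norm (x' + y') \<le> norm (x + y) + \<epsilon>"
        using close norm_triangle_ineq[of "x - y" "(x' - x) - (y' - y)"]
          norm_triangle_ineq4[of "x' - x" "y' - y"]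
          norm_triangle_ineq[of "x + y" "(x' - x) + (y' - y)"]
          norm_triangle_ineq[of "x' - x" "y' - y"]
        by (auto simp: algebra_simps)
      then have "max (norm (x' - y')) (norm (x' + y')) \<le> s + \<epsilon>" by (auto simp: s_eq)
      moreover have "Y \<in> F" using Y mem by (auto simp: F_def pos_sphere_def)
      moreover have "max (norm (x' - y')) (norm (x' + y')) \<in> L Y"
        using mem unfolding L_def by blast
      ultimately show ?thesis by blast
    qed
  qed
  moreover have "{lattice_schaeffer Y | Y :: 'a set.
      vector_sublattice Y \<and> finite_dimensional Y \<and> Y \<noteq> {0}} = (\<lambda>Y. Inf (L Y)) ` F"
    unfolding lattice_schaeffer_def L_def F_def image_Collect ..
  ultimately show "lattice_schaeffer (UNIV :: 'a set) =
      Inf {lattice_schaeffer Y | Y :: 'a set.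
             vector_sublattice Y \<and> finite_dimensional Y \<and> Y \<noteq> {0}}"
    by (simp add: lattice_schaeffer_def L_def)

  define M :: "'a set \<Rightarrow> real set" where
    "M = (\<lambda>Y. {norm (sup x y) | x y. x \<in> pos_sphere Y \<and> y \<in> pos_sphere Y \<and> inf x y = 0})"
  define G :: "'a set set" where
    "G = {Y. vector_sublattice Y \<and> finite_dimensional Y \<and> 2 \<le> dim Y}"
  have "Inf (M UNIV) = Inf ((\<lambda>Y. Inf (M Y)) ` G)"
  proof (rule Inf_exhausted_by_family)
    show "0 \<le> s" if "s \<in> M UNIV" for s using that by (auto simp: M_def)
    show "M UNIV \<noteq> {}" using disjoint_pair by (auto simp: M_def)
    show "M Y \<noteq> {} \<and> M Y \<subseteq> M UNIV" if "Y \<in> G" for Y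
    proof -
      have "\<nexists>a. Y \<subseteq> span {a}"
        using that by (intro not_line_if_dim_at_least_2)
          (auto simp: G_def vector_sublattice_def dim_at_least_def)
      then have "\<exists>x\<in>pos_sphere Y. \<exists>y\<in>pos_sphere Y. inf x y = 0"
        using that exists_disjoint_pair by (auto simp: G_def)
      then show ?thesis by (auto simp: M_def pos_sphere_def; blast)
    qed
    show "\<exists>Y\<in>G. \<exists>t\<in>M Y. t \<le> s + \<epsilon>" if s: "s \<in> M UNIV" and "0 < \<epsilon>" for s \<epsilon>
    proof -
      obtain x y :: 'a where x: "x \<in> pos_sphere UNIV" and y: "y \<in> pos_sphere UNIV"
        and xy: "inf x y = 0" "s = norm (sup x y)"
        using s by (auto simp: M_def)
      have "span {x, y} \<in> G" using disjoint_pair_span[OF x y xy(1)] by (simp add: G_def)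
      moreover have "x \<in> pos_sphere (span {x, y})" "y \<in> pos_sphere (span {x, y})"
        using x y by (auto simp: pos_sphere_def intro: span_base)
      ultimately show ?thesis
        using xy \<open>0 < \<epsilon>\<close> by (intro bexI[of _ "span {x, y}"] bexI[of _ s]) (auto simp: M_def)
    qed
  qed
  moreover have "{beta Y | Y :: 'a set.
      vector_sublattice Y \<and> finite_dimensional Y \<and> 2 \<le> dim Y} = (\<lambda>Y. Inf (M Y)) ` G"
    unfolding beta_def M_def G_def image_Collect ..
  ultimately show "beta (UNIV :: 'a set) =
      Inf {beta Y | Y :: 'a set. vector_sublattice Y \<and> finite_dimensional Y \<and> 2 \<le> dim Y}"
    by (simp add: beta_def M_def)
qed

end
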